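(* Let $G$ be an affine algebraic group over $\mathbb{C}$ and let $J$ be a Hopf $2$-cocycle for $\mathcal{O}(G)$. Then the algebra $\mathcal{O}(G)_J$ is finitely generated.
   Context: $\mathcal{O}(G)$ is the Hopf algebra of regular functions on $G$, with Sweedler notation $\Delta(a)=\sum a_1\otimes a_2$. A Hopf $2$-cocycle for a Hopf algebra $A$ is a linear map $J:A\otimes A\to\mathbb{C}$, invertible under the convolution product $*$ of $\mathrm{Hom}_{\mathbb{C}}(A\otimes A,\mathbb{C})$, such that $\sum J(a_1b_1,c)J(a_2,b_2)=\sum J(a,b_1c_1)J(b_2,c_2)$ and $J(a,1)=\varepsilon(a)=J(1,a)$ for all $a,b,c\in A$. $\mathcal{O}(G)_J$ is the unital associative algebra with underlying vector space $\mathcal{O}(G)$ and multiplication $m_J(a\otimes b)=\sum a_1b_1J(a_2,b_2)$. *)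

theory Defs
  imports "HOL-Analysis.Finite_Cartesian_Product" "HOL-Algebra.Module"
    "HOL-Library.Function_Algebras"
begin

section \<open>Affine algebraic groups over the complex numbers\<close>

text \<open>Polynomial functions, given a set \<open>C\<close> of coordinate functions on the affine space \<open>'a\<close>.\<close>

inductive_set poly_functions :: "('a \<Rightarrow> complex) set \<Rightarrow> ('a \<Rightarrow> complex) set"
  for C :: "('a \<Rightarrow> complex) set" where
  const: "(\<lambda>_. c) \<in> poly_functions C"
| coord: "f \<in> C \<Longrightarrow> f \<in> poly_functions C"
| add: "\<lbrakk>f \<in> poly_functions C; g \<in> poly_functions C\<rbrakk> \<Longrightarrow> f + g \<in> poly_functions C"
| mult: "\<lbrakk>f \<in> poly_functions C; g \<in> poly_functions C\<rbrakk> \<Longrightarrow> f * g \<in> poly_functions C"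

definition coords :: "(complex^'n \<Rightarrow> complex) set"
  where "coords = range (\<lambda>i x. x $ i)"

definition coords2 :: "((complex^'n) \<times> (complex^'n) \<Rightarrow> complex) set"
  where "coords2 = range (\<lambda>i z. fst z $ i) \<union> range (\<lambda>i z. snd z $ i)"

definition zariski_closed :: "(complex^'n) set \<Rightarrow> bool" where
  "zariski_closed X \<longleftrightarrow> (\<exists>P \<subseteq> poly_functions coords. X = {x. \<forall>p\<in>P. p x = 0})"

text \<open>An affine algebraic group is given by a closed embedding of its underlying affine variety
  into some affine space, multiplication and inversion being morphisms of varieties.\<close>

locale affine_algebraic_group = group G for G :: "(complex^'n) monoid" (structure) +
  assumes closed: "zariski_closed (carrier G)"
    and mult_morphism: "\<exists>p \<in> poly_functions coords2.
          \<forall>x \<in> carrier G. \<forall>y \<in> carrier G. (x \<otimes> y) $ i = p (x, y)"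
    and inv_morphism: "\<exists>p \<in> poly_functions coords. \<forall>x \<in> carrier G. (inv x) $ i = p x"


section \<open>The Hopf algebra of regular functions\<close>

text \<open>A function on \<open>G\<close> is represented by its extension by \<open>0\<close> to the ambient affine space, so
  that equality of functions on \<open>G\<close> is equality in HOL. Consequently the unit is the indicator
  function of \<open>G\<close>.\<close>

definition on_group :: "('g, 'm) monoid_scheme \<Rightarrow> ('g \<Rightarrow> complex) \<Rightarrow> 'g \<Rightarrow> complex"
  where "on_group G f = (\<lambda>x. if x \<in> carrier G then f x else 0)"

definition regular_algebra ::
  "(complex^'n) monoid \<Rightarrow> (complex, complex^'n \<Rightarrow> complex) module" (\<open>\<O>\<close>) where
  "\<O> G = \<lparr> carrier = on_group G ` poly_functions coords,
           monoid.mult = (\<lambda>a b. a * b), one = on_group G (\<lambda>_. 1),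
           zero = 0, add = (\<lambda>a b. a + b), smult = (\<lambda>c a x. c * a x) \<rparr>"

definition counit :: "(complex^'n) monoid \<Rightarrow> (complex^'n \<Rightarrow> complex) \<Rightarrow> complex"
  where "counit G a = a \<one>\<^bsub>G\<^esub>"

text \<open>The list \<open>[(u\<^sub>1, v\<^sub>1), \<dots>, (u\<^sub>k, v\<^sub>k)]\<close> stands for the tensor
  \<open>\<Sum>i. u\<^sub>i \<otimes> v\<^sub>i\<close>. Under the identification of \<open>\<O>(G) \<otimes> \<O>(G)\<close> with
  \<open>\<O>(G \<times> G)\<close>, the coproduct of \<open>a\<close> is the function \<open>(g, h) \<mapsto> a (g h)\<close>.\<close>

definition represents_coproduct :: "(complex^'n) monoid \<Rightarrow> (complex^'n \<Rightarrow> complex) \<Rightarrow>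
    ((complex^'n \<Rightarrow> complex) \<times> (complex^'n \<Rightarrow> complex)) list \<Rightarrow> bool" where
  "represents_coproduct G a ps \<longleftrightarrow>
     set ps \<subseteq> carrier (\<O> G) \<times> carrier (\<O> G) \<and>
     (\<forall>g \<in> carrier G. \<forall>h \<in> carrier G. a (g \<otimes>\<^bsub>G\<^esub> h) = (\<Sum>(u, v)\<leftarrow>ps. u g * v h))"

text \<open>\<open>sweedler G a \<Phi>\<close> is the Sweedler sum \<open>\<Sum> \<Phi>(a\<^sub>1, a\<^sub>2)\<close>. For bilinear \<open>\<Phi>\<close> it does not
  depend on the representative of the coproduct, see \<open>sweedler_eq\<close> below.\<close>

definition sweedler :: "(complex^'n) monoid \<Rightarrow> (complex^'n \<Rightarrow> complex) \<Rightarrow>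
    ((complex^'n \<Rightarrow> complex) \<Rightarrow> (complex^'n \<Rightarrow> complex) \<Rightarrow> 'v::comm_monoid_add) \<Rightarrow> 'v" where
  "sweedler G a \<Phi> = (THE s. \<exists>ps. represents_coproduct G a ps \<and> s = (\<Sum>(u, v)\<leftarrow>ps. \<Phi> u v))"


section \<open>Hopf 2-cocycles and the twisted algebra\<close>

text \<open>Linear maps \<open>\<O>(G) \<otimes> \<O>(G) \<rightarrow> \<complex>\<close> are rendered as bilinear forms on \<open>\<O>(G)\<close>; their
  values outside \<open>\<O>(G)\<close> are irrelevant.\<close>

type_synonym 'n form = "(complex^'n \<Rightarrow> complex) \<Rightarrow> (complex^'n \<Rightarrow> complex) \<Rightarrow> complex"

definition bilinear_form :: "(complex^'n) monoid \<Rightarrow> 'n form \<Rightarrow> bool" where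
  "bilinear_form G J \<longleftrightarrow>
     (\<forall>a \<in> carrier (\<O> G). \<forall>b \<in> carrier (\<O> G). \<forall>c \<in> carrier (\<O> G).
        J (a \<oplus>\<^bsub>\<O> G\<^esub> b) c = J a c + J b c \<and> J c (a \<oplus>\<^bsub>\<O> G\<^esub> b) = J c a + J c b) \<and>
     (\<forall>t. \<forall>a \<in> carrier (\<O> G). \<forall>b \<in> carrier (\<O> G).
        J (t \<odot>\<^bsub>\<O> G\<^esub> a) b = t * J a b \<and> J a (t \<odot>\<^bsub>\<O> G\<^esub> b) = t * J a b)"

definition convolution :: "(complex^'n) monoid \<Rightarrow> 'n form \<Rightarrow> 'n form \<Rightarrow> 'n form" where
  "convolution G J K a b =
     sweedler G a (\<lambda>a1 a2. sweedler G b (\<lambda>b1 b2. J a1 b1 * K a2 b2))"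

definition convolution_invertible :: "(complex^'n) monoid \<Rightarrow> 'n form \<Rightarrow> bool" where
  "convolution_invertible G J \<longleftrightarrow> (\<exists>K. bilinear_form G K \<and>
     (\<forall>a \<in> carrier (\<O> G). \<forall>b \<in> carrier (\<O> G).
        convolution G J K a b = counit G a * counit G b \<and>
        convolution G K J a b = counit G a * counit G b))"

definition hopf_2_cocycle :: "(complex^'n) monoid \<Rightarrow> 'n form \<Rightarrow> bool" where
  "hopf_2_cocycle G J \<longleftrightarrow>
     bilinear_form G J \<and> convolution_invertible G J \<and>
     (\<forall>a \<in> carrier (\<O> G). \<forall>b \<in> carrier (\<O> G). \<forall>c \<in> carrier (\<O> G).
        sweedler G a (\<lambda>a1 a2. sweedler G b (\<lambda>b1 b2. J (a1 \<otimes>\<^bsub>\<O> G\<^esub> b1) c * J a2 b2)) =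
        sweedler G b (\<lambda>b1 b2. sweedler G c (\<lambda>c1 c2. J a (b1 \<otimes>\<^bsub>\<O> G\<^esub> c1) * J b2 c2))) \<and>
     (\<forall>a \<in> carrier (\<O> G). J a \<one>\<^bsub>\<O> G\<^esub> = counit G a \<and> J \<one>\<^bsub>\<O> G\<^esub> a = counit G a)"

definition twisted_mult :: "(complex^'n) monoid \<Rightarrow> 'n form \<Rightarrow>
    (complex^'n \<Rightarrow> complex) \<Rightarrow> (complex^'n \<Rightarrow> complex) \<Rightarrow> (complex^'n \<Rightarrow> complex)" where
  "twisted_mult G J a b =
     sweedler G a (\<lambda>a1 a2. sweedler G b (\<lambda>b1 b2. J a2 b2 \<odot>\<^bsub>\<O> G\<^esub> (a1 \<otimes>\<^bsub>\<O> G\<^esub> b1)))"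

definition twisted_algebra ::
  "(complex^'n) monoid \<Rightarrow> 'n form \<Rightarrow> (complex, complex^'n \<Rightarrow> complex) module" where
  "twisted_algebra G J = (\<O> G)\<lparr> monoid.mult := twisted_mult G J \<rparr>"


section \<open>Finitely generated algebras\<close>

text \<open>The unital subalgebra generated by \<open>S\<close>; the algebra need not be commutative.\<close>

inductive_set generated_subalgebra :: "(complex, 'v) module \<Rightarrow> 'v set \<Rightarrow> 'v set"
  for A :: "(complex, 'v) module" (structure) and S :: "'v set" where
  one: "\<one> \<in> generated_subalgebra A S"
| gen: "s \<in> S \<Longrightarrow> s \<in> generated_subalgebra A S"
| smult: "a \<in> generated_subalgebra A S \<Longrightarrow> t \<odot> a \<in> generated_subalgebra A S"
| add: "\<lbrakk>a \<in> generated_subalgebra A S; b \<in> generated_subalgebra A S\<rbrakk>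
    \<Longrightarrow> a \<oplus> b \<in> generated_subalgebra A S"
| mult: "\<lbrakk>a \<in> generated_subalgebra A S; b \<in> generated_subalgebra A S\<rbrakk>
    \<Longrightarrow> a \<otimes> b \<in> generated_subalgebra A S"

definition finitely_generated_algebra :: "(complex, 'v) module \<Rightarrow> bool" where
  "finitely_generated_algebra A \<longleftrightarrow>
     (\<exists>S. finite S \<and> S \<subseteq> carrier A \<and> generated_subalgebra A S = carrier A)"


section \<open>Sweedler sums are well defined\<close>

lemma regular_closed:
  fixes G :: "(complex^'n) monoid"
  shows "0 \<in> carrier (\<O> G)"
    and "a \<in> carrier (\<O> G) \<Longrightarrow> b \<in> carrier (\<O> G) \<Longrightarrow> a + b \<in> carrier (\<O> G)"
    and "a \<in> carrier (\<O> G) \<Longrightarrow> b \<in> carrier (\<O> G) \<Longrightarrow> a * b \<in> carrier (\<O> G)"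
    and "a \<in> carrier (\<O> G) \<Longrightarrow> (\<lambda>x. t * a x) \<in> carrier (\<O> G)"
    and "a \<in> carrier (\<O> G) \<Longrightarrow> x \<notin> carrier G \<Longrightarrow> a x = 0"
proof -
  have "0 = on_group G (\<lambda>_. 0)" by (auto simp: on_group_def)
  then show "0 \<in> carrier (\<O> G)"
    unfolding regular_algebra_def by (auto intro: poly_functions.const)
  show "a + b \<in> carrier (\<O> G)" if ab: "a \<in> carrier (\<O> G)" "b \<in> carrier (\<O> G)"
  proof -
    from ab obtain p q where "p \<in> poly_functions coords" "q \<in> poly_functions coords"
      "a = on_group G p" "b = on_group G q" by (auto simp: regular_algebra_def)
    moreover have "on_group G p + on_group G q = on_group G (p + q)"
      by (auto simp: on_group_def)
    ultimately show ?thesis by (auto simp: regular_algebra_def intro: poly_functions.add)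
  qed
  show "a * b \<in> carrier (\<O> G)" if ab: "a \<in> carrier (\<O> G)" "b \<in> carrier (\<O> G)"
  proof -
    from ab obtain p q where "p \<in> poly_functions coords" "q \<in> poly_functions coords"
      "a = on_group G p" "b = on_group G q" by (auto simp: regular_algebra_def)
    moreover have "on_group G p * on_group G q = on_group G (p * q)"
      by (auto simp: on_group_def)
    ultimately show ?thesis by (auto simp: regular_algebra_def intro: poly_functions.mult)
  qed
  show "(\<lambda>x. t * a x) \<in> carrier (\<O> G)" if a: "a \<in> carrier (\<O> G)"
  proof -
    from a obtain p where "p \<in> poly_functions coords" "a = on_group G p"
      by (auto simp: regular_algebra_def)
    moreover have "(\<lambda>x. t * on_group G p x) = on_group G ((\<lambda>_. t) * p)"
      by (auto simp: on_group_def)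
    ultimately show ?thesis
      by (auto simp: regular_algebra_def intro: poly_functions.mult poly_functions.const)
  qed
  show "a \<in> carrier (\<O> G) \<Longrightarrow> x \<notin> carrier G \<Longrightarrow> a x = 0"
    by (auto simp: regular_algebra_def on_group_def)
qed

lemma tensor_zero:
  fixes \<Phi> :: "('a \<Rightarrow> complex) \<Rightarrow> ('a \<Rightarrow> complex) \<Rightarrow> 'v::ab_group_add"
  assumes V0: "0 \<in> V" and Vadd: "\<And>a b. a \<in> V \<Longrightarrow> b \<in> V \<Longrightarrow> a + b \<in> V"
    and Vsc: "\<And>t a. a \<in> V \<Longrightarrow> (\<lambda>x. t * a x) \<in> V"
    and addl: "\<And>a b c. a \<in> V \<Longrightarrow> b \<in> V \<Longrightarrow> c \<in> V \<Longrightarrow> \<Phi> (a + b) c = \<Phi> a c + \<Phi> b c"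
    and addr: "\<And>a b c. a \<in> V \<Longrightarrow> b \<in> V \<Longrightarrow> c \<in> V \<Longrightarrow> \<Phi> c (a + b) = \<Phi> c a + \<Phi> c b"
    and bal: "\<And>t a b. a \<in> V \<Longrightarrow> b \<in> V \<Longrightarrow> \<Phi> (\<lambda>x. t * a x) b = \<Phi> a (\<lambda>x. t * b x)"
  shows "set ps \<subseteq> V \<times> V \<Longrightarrow> (\<And>g h. (\<Sum>(u, v)\<leftarrow>ps. u g * v h) = 0)
    \<Longrightarrow> (\<Sum>(u, v)\<leftarrow>ps. \<Phi> u v) = 0"
proof (induction "length ps" arbitrary: ps)
  case 0
  then show ?case by simp
next
  case (Suc n)
  then obtain u v qs where ps: "ps = (u, v) # qs" by (cases ps) auto
  have uv: "u \<in> V" "v \<in> V" and qs: "set qs \<subseteq> V \<times> V" using Suc.prems(1) ps by auto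
  have len: "n = length qs" using Suc.hyps(2) ps by simp
  have sum0: "u g * v h + (\<Sum>(u, v)\<leftarrow>qs. u g * v h) = 0" for g h
    using Suc.prems(2)[of g h] ps by simp
  have \<Phi>0l: "\<Phi> 0 c = 0" if "c \<in> V" for c using addl[OF V0 V0 that] by simp
  have \<Phi>0r: "\<Phi> c 0 = 0" if "c \<in> V" for c using addr[OF V0 V0 that] by simp
  show ?case
  proof (cases "v = 0")
    case True
    then have "(\<Sum>(u, v)\<leftarrow>qs. \<Phi> u v) = 0" using Suc.hyps(1)[OF len qs] sum0 by simp
    then show ?thesis using True ps \<Phi>0r uv by simp
  next
    case False
    then obtain h0 where h0: "v h0 \<noteq> 0" by (auto simp: fun_eq_iff)
    define c where "c w = - (w h0 / v h0)" for w :: "'a \<Rightarrow> complex"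
    define rs where "rs = map (\<lambda>(u', w). (u', w + (\<lambda>x. c w * v x))) qs"
    have rs: "set rs \<subseteq> V \<times> V" using qs uv by (auto simp: rs_def intro!: Vadd Vsc)
    have u: "u = (\<lambda>g. (\<Sum>(u', w)\<leftarrow>qs. c w * u' g))"
    proof
      fix g
      have "(\<Sum>(u', w)\<leftarrow>qs. c w * u' g) = - (\<Sum>(u', w)\<leftarrow>qs. u' g * w h0) / v h0"
        by (induction qs) (auto simp: c_def field_simps h0)
      also have "\<dots> = u g" using sum0[of g h0] h0 by (simp add: field_simps add_eq_0_iff2)
      finally show "u g = (\<Sum>(u', w)\<leftarrow>qs. c w * u' g)" by simp
    qed
    have "(\<Sum>(u', w)\<leftarrow>rs. u' g * w h) = u g * v h + (\<Sum>(u, v)\<leftarrow>qs. u g * v h)" for g h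
      unfolding rs_def by (subst u, induction qs) (auto simp: algebra_simps)
    then have "(\<Sum>(u', w)\<leftarrow>rs. \<Phi> u' w) = 0"
      using Suc.hyps(1)[of rs] rs sum0 len by (simp add: rs_def)
    moreover have "(\<lambda>g. (\<Sum>(u', w)\<leftarrow>qs. c w * u' g)) \<in> V \<and>
       (\<Sum>(u', w)\<leftarrow>rs. \<Phi> u' w) =
       \<Phi> (\<lambda>g. (\<Sum>(u', w)\<leftarrow>qs. c w * u' g)) v + (\<Sum>(u', w)\<leftarrow>qs. \<Phi> u' w)"
      using qs unfolding rs_def
    proof (induction qs)
      case Nil
      have "(\<lambda>g. 0) = (0 :: 'a \<Rightarrow> complex)" by auto
      then show ?case using V0 \<Phi>0l uv by simp
    next
      case (Cons q qs)
      obtain u' w where q: "q = (u', w)" by (cases q)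
      let ?S = "\<lambda>g. (\<Sum>(u', w)\<leftarrow>qs. c w * u' g)"
      have in_V: "u' \<in> V" "w \<in> V" "?S \<in> V" using Cons q by auto
      have eq: "(\<lambda>g. (\<Sum>(u', w)\<leftarrow>q # qs. c w * u' g)) = (\<lambda>g. c w * u' g) + ?S"
        using q by auto
      have left: "\<Phi> ((\<lambda>g. c w * u' g) + ?S) v = \<Phi> u' (\<lambda>g. c w * v g) + \<Phi> ?S v"
        using in_V uv by (simp only: addl bal Vsc)
      have right: "\<Phi> u' (w + (\<lambda>g. c w * v g)) = \<Phi> u' w + \<Phi> u' (\<lambda>g. c w * v g)"
        using in_V uv by (simp only: addr Vsc)
      have mem: "(\<lambda>g. c w * u' g) + ?S \<in> V"
        using in_V by (intro Vadd Vsc)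
      have IH: "(\<Sum>(u', w)\<leftarrow>map (\<lambda>(u', w). (u', w + (\<lambda>x. c w * v x))) qs. \<Phi> u' w) =
          \<Phi> ?S v + (\<Sum>(u', w)\<leftarrow>qs. \<Phi> u' w)"
        using Cons.IH Cons.prems by (meson insert_subset list.simps(15) order_trans set_subset_Cons)
      have "(\<Sum>(u', w)\<leftarrow>map (\<lambda>(u', w). (u', w + (\<lambda>x. c w * v x))) (q # qs). \<Phi> u' w) =
          \<Phi> u' (w + (\<lambda>g. c w * v g)) +
          (\<Sum>(u', w)\<leftarrow>map (\<lambda>(u', w). (u', w + (\<lambda>x. c w * v x))) qs. \<Phi> u' w)"
        using q by simp
      also have "\<dots> = \<Phi> ((\<lambda>g. c w * u' g) + ?S) v + (\<Sum>(u', w)\<leftarrow>q # qs. \<Phi> u' w)"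
        unfolding IH left right using q by (simp add: algebra_simps)
      finally show ?case unfolding eq using mem by blast
    qed
    ultimately show ?thesis using ps u by simp
  qed
qed

lemma sweedler_eq:
  fixes \<Phi> :: "(complex^'n \<Rightarrow> complex) \<Rightarrow> (complex^'n \<Rightarrow> complex) \<Rightarrow> 'v::ab_group_add"
  assumes addl: "\<And>a b c. a \<in> carrier (\<O> G) \<Longrightarrow> b \<in> carrier (\<O> G) \<Longrightarrow> c \<in> carrier (\<O> G) \<Longrightarrow>
      \<Phi> (a + b) c = \<Phi> a c + \<Phi> b c"
    and addr: "\<And>a b c. a \<in> carrier (\<O> G) \<Longrightarrow> b \<in> carrier (\<O> G) \<Longrightarrow> c \<in> carrier (\<O> G) \<Longrightarrow>
      \<Phi> c (a + b) = \<Phi> c a + \<Phi> c b"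
    and bal: "\<And>t a b. a \<in> carrier (\<O> G) \<Longrightarrow> b \<in> carrier (\<O> G) \<Longrightarrow>
      \<Phi> (\<lambda>x. t * a x) b = \<Phi> a (\<lambda>x. t * b x)"
    and ps: "represents_coproduct G a ps"
  shows "sweedler G a \<Phi> = (\<Sum>(u, v)\<leftarrow>ps. \<Phi> u v)"
  unfolding sweedler_def
proof (rule the_equality)
  show "\<exists>qs. represents_coproduct G a qs \<and> (\<Sum>(u, v)\<leftarrow>ps. \<Phi> u v) = (\<Sum>(u, v)\<leftarrow>qs. \<Phi> u v)"
    using ps by blast
next
  fix s assume "\<exists>qs. represents_coproduct G a qs \<and> s = (\<Sum>(u, v)\<leftarrow>qs. \<Phi> u v)"
  then obtain qs where qs: "represents_coproduct G a qs" and s: "s = (\<Sum>(u, v)\<leftarrow>qs. \<Phi> u v)"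
    by blast
  let ?V = "carrier (\<O> G)"
  define rs where "rs = map (\<lambda>(u, v). (\<lambda>x. (-1) * u x, v)) qs"
  have sub: "set ps \<subseteq> ?V \<times> ?V" "set qs \<subseteq> ?V \<times> ?V"
    using ps qs by (auto simp: represents_coproduct_def)
  have rs_V: "set (ps @ rs) \<subseteq> ?V \<times> ?V"
  proof -
    have "set rs \<subseteq> ?V \<times> ?V"
      using sub(2) regular_closed(4)[where G = G and t = "-1"] by (auto simp: rs_def)
    then show ?thesis using sub(1) by auto
  qed
  have neg: "\<Phi> (\<lambda>x. (-1) * u x) v = - \<Phi> u v" if "u \<in> ?V" "v \<in> ?V" for u v
  proof -
    have "\<Phi> 0 v = 0" using addl[of 0 0 v] regular_closed(1)[of G] that by simp
    moreover have "u + (\<lambda>x. (-1) * u x) = 0" by auto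
    ultimately show ?thesis
      using addl[of u "\<lambda>x. (-1) * u x" v] that regular_closed(4)[of u G "-1"]
      by (simp add: eq_neg_iff_add_eq_0 add.commute)
  qed
  have rs1: "(\<Sum>(u, v)\<leftarrow>rs. u g * v h) = - (\<Sum>(u, v)\<leftarrow>qs. u g * v h)" for g h
    unfolding rs_def by (induction qs) auto
  have rs2: "(\<Sum>(u, v)\<leftarrow>rs. \<Phi> u v) = - (\<Sum>(u, v)\<leftarrow>qs. \<Phi> u v)"
    unfolding rs_def using sub(2) by (induction qs) (auto simp: neg[simplified])
  have outside: "(\<Sum>(u, v)\<leftarrow>xs. u g * v h) = 0"
    if "set xs \<subseteq> ?V \<times> ?V" "g \<notin> carrier G \<or> h \<notin> carrier G" for xs g h
    using that by (induction xs) (auto simp: regular_closed(5))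
  have "(\<Sum>(u, v)\<leftarrow>ps @ rs. u g * v h) = 0" for g h
  proof (cases "g \<in> carrier G \<and> h \<in> carrier G")
    case True
    then show ?thesis using ps qs rs1 by (simp add: represents_coproduct_def)
  next
    case False
    then show ?thesis using outside[OF rs_V] by blast
  qed
  then have "(\<Sum>(u, v)\<leftarrow>ps @ rs. \<Phi> u v) = 0"
    by (intro tensor_zero[of ?V \<Phi> "ps @ rs"] regular_closed(1,2,4) addl addr bal rs_V)
  then show "s = (\<Sum>(u, v)\<leftarrow>ps. \<Phi> u v)" using rs2 s by simp
qed

lemma (in affine_algebraic_group) coproduct_exists:
  assumes "a \<in> carrier (\<O> G)"
  shows "\<exists>ps. represents_coproduct G a ps"
proof -
  let ?V = "carrier (\<O> G)"
  define D where "D F \<longleftrightarrow> (\<exists>ps. set ps \<subseteq> ?V \<times> ?V \<and> (\<forall>g \<in> carrier G. \<forall>h \<in> carrier G.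
     F g h = (\<Sum>(u, v)\<leftarrow>ps. u g * v h)))" for F
  have poly_V: "on_group G p \<in> ?V" if "p \<in> poly_functions coords" for p
    using that by (auto simp: regular_algebra_def)
  have D_single: "D (\<lambda>g h. p g * q h)"
    if "p \<in> poly_functions coords" "q \<in> poly_functions coords" for p q
    unfolding D_def using poly_V[OF that(1)] poly_V[OF that(2)]
    by (intro exI[of _ "[(on_group G p, on_group G q)]"]) (simp, simp add: on_group_def)
  have D_const: "D (\<lambda>g h. c)" for c
    using D_single[OF poly_functions.const[of c] poly_functions.const[of 1]] by simp
  have D_add: "D (\<lambda>g h. F g h + F' g h)" if "D F" "D F'" for F F'
  proof -
    from that obtain ps qs where "set ps \<subseteq> ?V \<times> ?V" "set qs \<subseteq> ?V \<times> ?V"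
      "\<forall>g \<in> carrier G. \<forall>h \<in> carrier G. F g h = (\<Sum>(u, v)\<leftarrow>ps. u g * v h)"
      "\<forall>g \<in> carrier G. \<forall>h \<in> carrier G. F' g h = (\<Sum>(u, v)\<leftarrow>qs. u g * v h)"
      unfolding D_def by blast
    then show ?thesis unfolding D_def by (intro exI[of _ "ps @ qs"]) auto
  qed
  have D_mult: "D (\<lambda>g h. F g h * F' g h)" if F: "D F" "D F'" for F F'
  proof -
    from F obtain ps qs where ps: "set ps \<subseteq> ?V \<times> ?V" and qs: "set qs \<subseteq> ?V \<times> ?V"
      and eq: "\<forall>g \<in> carrier G. \<forall>h \<in> carrier G. F g h = (\<Sum>(u, v)\<leftarrow>ps. u g * v h)"
        "\<forall>g \<in> carrier G. \<forall>h \<in> carrier G. F' g h = (\<Sum>(u, v)\<leftarrow>qs. u g * v h)"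
      unfolding D_def by blast
    define rs where "rs = concat (map (\<lambda>(u, v). map (\<lambda>(u', v'). (u * u', v * v')) qs) ps)"
    have inner: "(\<Sum>(u', v')\<leftarrow>map (\<lambda>(u', v'). (u * u', v * v')) qs. u' g * v' h) =
      u g * v h * (\<Sum>(u', v')\<leftarrow>qs. u' g * v' h)" for g h u v
      by (induction qs) (auto simp: algebra_simps)
    have "(\<Sum>(u, v)\<leftarrow>rs. u g * v h) =
      (\<Sum>(u, v)\<leftarrow>ps. u g * v h) * (\<Sum>(u, v)\<leftarrow>qs. u g * v h)" for g h
      unfolding rs_def
    proof (induction ps)
      case (Cons q ps)
      then show ?case
        by (cases q) (simp add: inner distrib_right del: map_map times_fun_apply)
    qed simp
    moreover have "set rs \<subseteq> ?V \<times> ?V"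
    proof
      fix r assume "r \<in> set rs"
      then obtain p q where "p \<in> set ps" "q \<in> set qs"
        and r: "r = (fst p * fst q, snd p * snd q)"
        unfolding rs_def case_prod_unfold set_concat set_map image_image by blast
      then have "fst p \<in> ?V" "snd p \<in> ?V" "fst q \<in> ?V" "snd q \<in> ?V"
        using ps qs by auto
      then show "r \<in> ?V \<times> ?V" unfolding r by (intro SigmaI regular_closed(3))
    qed
    ultimately show ?thesis unfolding D_def using eq by (intro exI[of _ rs]) auto
  qed
  have D_poly2: "D (\<lambda>g h. p (g, h))" if "p \<in> poly_functions coords2" for p
    using that
  proof induction
    case (const c)
    then show ?case by (rule D_const)
  next
    case (coord f)
    then consider i where "f = (\<lambda>z. fst z $ i)" | i where "f = (\<lambda>z. snd z $ i)"
      unfolding coords2_def by blast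
    then show ?case
    proof cases
      case (1 i)
      have "(\<lambda>x::complex^'n. x $ i) \<in> poly_functions coords"
        by (rule poly_functions.coord) (simp add: coords_def)
      from D_single[OF this poly_functions.const[of 1]] show ?thesis using 1 by simp
    next
      case (2 i)
      have "(\<lambda>x::complex^'n. x $ i) \<in> poly_functions coords"
        by (rule poly_functions.coord) (simp add: coords_def)
      from D_single[OF poly_functions.const[of 1] this] show ?thesis using 2 by simp
    qed
  next
    case (add f g)
    then show ?case using D_add by simp
  next
    case (mult f g)
    then show ?case using D_mult by simp
  qed
  have D_cong: "D F'" if "D F" "\<And>g h. g \<in> carrier G \<Longrightarrow> h \<in> carrier G \<Longrightarrow> F g h = F' g h" for F F'
    using that unfolding D_def by simp
  have D_poly: "D (\<lambda>g h. p (g \<otimes> h))" if "p \<in> poly_functions coords" for p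
    using that
  proof induction
    case (const c)
    then show ?case by (rule D_const)
  next
    case (coord f)
    then obtain i where f: "f = (\<lambda>x. x $ i)" unfolding coords_def by blast
    obtain p where p: "p \<in> poly_functions coords2"
      "\<forall>x \<in> carrier G. \<forall>y \<in> carrier G. (x \<otimes> y) $ i = p (x, y)"
      using mult_morphism by blast
    show ?case by (rule D_cong[OF D_poly2[OF p(1)]]) (simp add: f p(2))
  next
    case (add f g)
    then show ?case using D_add by simp
  next
    case (mult f g)
    then show ?case using D_mult by simp
  qed
  from assms obtain p where p: "p \<in> poly_functions coords" "a = on_group G p"
    by (auto simp: regular_algebra_def)
  have "D (\<lambda>g h. a (g \<otimes> h))"
    by (rule D_cong[OF D_poly[OF p(1)]]) (simp add: p(2) on_group_def)
  then show ?thesis unfolding D_def represents_coproduct_def by simp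
qed

end

theory Submission
  imports Defs
begin

text \<open>Let \<open>K\<close> be the convolution inverse of \<open>J\<close>. The twist can be undone:
  \<open>a b = \<Sum> K(a\<^sub>2, b\<^sub>2) m\<^sub>J(a\<^sub>1 \<otimes> b\<^sub>1)\<close>. Choose tensors representing the
  coproducts of the coordinate functions, and let \<open>B\<close> be the subalgebra of \<open>\<O>(G)\<^sub>J\<close>
  generated by their left factors. The functions all of whose right translates lie in \<open>B\<close> form a
  subspace \<open>Q\<close> of \<open>B\<close> containing the coordinate functions. It is translation invariant, so
  \<open>\<Delta>(Q) \<subseteq> Q \<otimes> \<O>(G)\<close>, and the displayed formula shows that \<open>Q\<close> is closed under the
  commutative product. Hence \<open>Q = \<O>(G)\<close>.\<close>

section \<open>Sums over lists of pairs, and tensors with left factors in a subspace\<close>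

lemma sum_list_case_prod_apply:
  fixes F :: "'b \<Rightarrow> 'c \<Rightarrow> 'a \<Rightarrow> 'v::comm_monoid_add"
  shows "(\<Sum>(u, v)\<leftarrow>ps. F u v) x = (\<Sum>(u, v)\<leftarrow>ps. F u v x)"
  by (induction ps) auto

lemma sum_list_case_prod_closed:
  fixes F :: "'b \<Rightarrow> 'c \<Rightarrow> 'v::comm_monoid_add"
  assumes "0 \<in> W" and "\<And>x y. x \<in> W \<Longrightarrow> y \<in> W \<Longrightarrow> x + y \<in> W"
    and "\<And>u v. (u, v) \<in> set ps \<Longrightarrow> F u v \<in> W"
  shows "(\<Sum>(u, v)\<leftarrow>ps. F u v) \<in> W"
  using assms(3) by (induction ps) (auto intro: assms(1,2))

lemma sum_list_case_prod_cong:
  assumes "\<And>u v. (u, v) \<in> set ps \<Longrightarrow> F u v = F' u v"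
  shows "(\<Sum>(u, v)\<leftarrow>ps. F u v) = (\<Sum>(u, v)\<leftarrow>ps. F' u v)"
  using assms by (intro arg_cong[of _ _ sum_list] map_cong) auto

text \<open>A left factor can be replaced by a slice of \<open>F\<close>: where a right factor
  \<open>v\<close> is nonzero at \<open>h0\<close>, the slice \<open>F _ h0\<close> lies in
  \<open>Q\<close> and can stand next to \<open>v\<close>. Removing this rank-one tensor leaves a
  shorter representation whose slices are again in \<open>Q\<close>, so induction on the length
  applies. Nothing is assumed about the original left factors.\<close>

lemma tensor_left_factors:
  fixes F :: "'a \<Rightarrow> 'b \<Rightarrow> complex"
  assumes Q0: "0 \<in> Q" and Qadd: "\<And>a b. a \<in> Q \<Longrightarrow> b \<in> Q \<Longrightarrow> a + b \<in> Q"
    and Qsc: "\<And>t a. a \<in> Q \<Longrightarrow> (\<lambda>x. t * a x) \<in> Q"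
    and Vadd: "\<And>a b. a \<in> V \<Longrightarrow> b \<in> V \<Longrightarrow> a + b \<in> V"
    and Vsc: "\<And>t a. a \<in> V \<Longrightarrow> (\<lambda>x. t * a x) \<in> V"
    and "snd ` set ps \<subseteq> V" and "\<And>g h. F g h = (\<Sum>(u, v)\<leftarrow>ps. u g * v h)"
    and "\<And>h. (\<lambda>g. F g h) \<in> Q"
  shows "\<exists>qs. set qs \<subseteq> Q \<times> V \<and> (\<forall>g h. F g h = (\<Sum>(u, v)\<leftarrow>qs. u g * v h))"
  using assms(6-8)
proof (induction "length ps" arbitrary: ps F)
  case 0
  then show ?case by (intro exI[of _ "[]"]) simp
next
  case (Suc n)
  then obtain u v rs where ps: "ps = (u, v) # rs" by (cases ps) auto
  have len: "n = length rs" and v: "v \<in> V" and rs: "snd ` set rs \<subseteq> V"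
    using Suc.hyps(2) Suc.prems(1) ps by auto
  have F: "F g h = u g * v h + (\<Sum>(u, v)\<leftarrow>rs. u g * v h)" for g h
    using Suc.prems(2) ps by simp
  show ?case
  proof (cases "v = 0")
    case True
    then show ?thesis using Suc.hyps(1)[OF len rs _ Suc.prems(3)] F by simp
  next
    case False
    then obtain h0 where h0: "v h0 \<noteq> 0" by (auto simp: fun_eq_iff)
    \<comment> \<open>The coefficient \<open>c w\<close> makes \<open>w + c w * v\<close> vanish at
      \<open>h0\<close>. Subtracting \<open>F g h0 * (v h / v h0)\<close> from \<open>F\<close>
      cancels the term \<open>u \<otimes> v\<close> and replaces every other right factor
      \<open>w\<close> by this combination.\<close>
    define c where "c w = - (w h0 / v h0)" for w :: "'b \<Rightarrow> complex"
    define rs' where "rs' = map (\<lambda>(u, w). (u, w + (\<lambda>x. c w * v x))) rs"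
    define F' where "F' g h = F g h - v h / v h0 * F g h0" for g h
    have len': "n = length rs'" using len by (simp add: rs'_def)
    have rs': "snd ` set rs' \<subseteq> V"
      using rs v by (fastforce simp: rs'_def intro!: Vadd Vsc)
    have "(\<Sum>(u, v)\<leftarrow>rs'. u g * v h) =
        (\<Sum>(u, v)\<leftarrow>rs. u g * v h) - v h / v h0 * (\<Sum>(u, v)\<leftarrow>rs. u g * v h0)" for g h
      unfolding rs'_def c_def by (induction rs) (auto simp: algebra_simps)
    then have F'_eq: "F' g h = (\<Sum>(u, v)\<leftarrow>rs'. u g * v h)" for g h
      unfolding F'_def F using h0 by (simp add: add_divide_distrib algebra_simps)
    have F'_Q: "(\<lambda>g. F' g h) \<in> Q" for h
    proof -
      have eq: "(\<lambda>g. F' g h) = (\<lambda>g. F g h) + (\<lambda>g. - (v h / v h0) * F g h0)"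
        by (auto simp: F'_def)
      show ?thesis unfolding eq by (intro Qadd Qsc Suc.prems(3))
    qed
    obtain qs where qs: "set qs \<subseteq> Q \<times> V" "\<forall>g h. F' g h = (\<Sum>(u, v)\<leftarrow>qs. u g * v h)"
      using Suc.hyps(1)[OF len' rs' F'_eq F'_Q] by blast
    \<comment> \<open>The rank-one tensor removed in \<open>F'\<close> is put back; its left factor
      is a slice, hence in \<open>Q\<close>.\<close>
    define q where "q = (\<lambda>g. F g h0, \<lambda>h. 1 / v h0 * v h)"
    have "set (q # qs) \<subseteq> Q \<times> V" using qs(1) Suc.prems(3) Vsc[OF v, of "1 / v h0"] by (simp add: q_def)
    moreover have "F g h = (\<Sum>(u, v)\<leftarrow>q # qs. u g * v h)" for g h
      using qs(2)[rule_format, of g h] by (simp add: q_def F'_def algebra_simps)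
    ultimately show ?thesis by blast
  qed
qed

section \<open>Bilinear forms on the regular functions\<close>

lemma regular_algebra_simps [simp]:
  "monoid.mult (\<O> G) = (\<lambda>a b. a * b)" "one (\<O> G) = on_group G (\<lambda>_. 1)"
  "zero (\<O> G) = 0" "add (\<O> G) = (\<lambda>a b. a + b)" "smult (\<O> G) = (\<lambda>c a x. c * a x)"
  by (simp_all add: regular_algebra_def)

lemma twisted_algebra_simps [simp]:
  "carrier (twisted_algebra G J) = carrier (\<O> G)"
  "monoid.mult (twisted_algebra G J) = twisted_mult G J"
  "one (twisted_algebra G J) = on_group G (\<lambda>_. 1)"
  "zero (twisted_algebra G J) = 0" "add (twisted_algebra G J) = (\<lambda>a b. a + b)"
  "smult (twisted_algebra G J) = (\<lambda>c a x. c * a x)"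
  by (simp_all add: twisted_algebra_def)

lemma on_group_const_regular: "on_group G (\<lambda>_. c) \<in> carrier (\<O> G)"
  by (auto simp: regular_algebra_def intro: poly_functions.const)

lemma on_group_coord_regular: "on_group G (\<lambda>x. x $ i) \<in> carrier (\<O> G)"
  by (auto simp: regular_algebra_def coords_def intro!: imageI poly_functions.coord)

lemma bilinear_formD:
  assumes "bilinear_form G J"
    and "a \<in> carrier (\<O> G)" "b \<in> carrier (\<O> G)" "c \<in> carrier (\<O> G)"
  shows "J (a + b) c = J a c + J b c" "J c (a + b) = J c a + J c b"
    and "J (\<lambda>x. t * a x) b = t * J a b" "J a (\<lambda>x. t * b x) = t * J a b"
  using assms unfolding bilinear_form_def by auto

text \<open>For fixed \<open>g\<close> the values \<open>u g\<close> are scalars, so this is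
  linearity. Membership is proved in the same induction because \<open>bilinear_form\<close> gives
  linearity only on \<open>carrier (\<O> G)\<close>.\<close>

lemma bilinear_form_sum_left:
  assumes J: "bilinear_form G J" and b: "b \<in> carrier (\<O> G)"
    and ps: "set ps \<subseteq> carrier (\<O> G) \<times> carrier (\<O> G)"
  shows "(\<lambda>h. \<Sum>(u, v)\<leftarrow>ps. u g * v h) \<in> carrier (\<O> G) \<and>
    J (\<lambda>h. \<Sum>(u, v)\<leftarrow>ps. u g * v h) b = (\<Sum>(u, v)\<leftarrow>ps. u g * J v b)"
  using ps
proof (induction ps)
  case Nil
  have "J 0 b = 0" using bilinear_formD(1)[OF J regular_closed(1) regular_closed(1) b] by simp
  then show ?case using regular_closed(1)[of G] by (simp add: zero_fun_def)
next
  case (Cons q ps)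
  obtain u v where q: "q = (u, v)" by (cases q)
  have "(\<lambda>h. \<Sum>(u, v)\<leftarrow>q # ps. u g * v h) =
      (\<lambda>h. u g * v h) + (\<lambda>h. \<Sum>(u, v)\<leftarrow>ps. u g * v h)"
    by (auto simp: q)
  moreover have "v \<in> carrier (\<O> G)" using Cons.prems by (simp add: q)
  ultimately show ?case
    using Cons b by (simp add: q bilinear_formD[OF J] regular_closed(2,4))
qed

lemma bilinear_form_flip: "bilinear_form G J \<Longrightarrow> bilinear_form G (\<lambda>a b. J b a)"
  by (simp add: bilinear_form_def)

section \<open>Evaluating iterated Sweedler sums\<close>

text \<open>Two applications of \<open>sweedler_eq\<close>. Once the inner Sweedler sum is a finite
  sum over \<open>qs\<close>, it inherits biadditivity and balance in the first two arguments from
  \<open>\<Phi>\<close>, so the outer sum is independent of the representative as well. The value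
  type is general in order to cover both the scalar-valued convolution and the function-valued
  twisted product.\<close>

lemma sweedler_sweedler_eq:
  fixes G :: "(complex^'n) monoid"
    and \<Phi> :: "(complex^'n \<Rightarrow> complex) \<Rightarrow> (complex^'n \<Rightarrow> complex) \<Rightarrow>
    (complex^'n \<Rightarrow> complex) \<Rightarrow> (complex^'n \<Rightarrow> complex) \<Rightarrow> 'v::ab_group_add"
  defines "V \<equiv> carrier (\<O> G)"
  assumes add: "\<And>a a' b c d. a \<in> V \<Longrightarrow> a' \<in> V \<Longrightarrow> b \<in> V \<Longrightarrow> c \<in> V \<Longrightarrow> d \<in> V \<Longrightarrow>
      \<Phi> (a + a') b c d = \<Phi> a b c d + \<Phi> a' b c d \<and> \<Phi> b (a + a') c d = \<Phi> b a c d + \<Phi> b a' c d \<and>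
      \<Phi> b c (a + a') d = \<Phi> b c a d + \<Phi> b c a' d \<and> \<Phi> b c d (a + a') = \<Phi> b c d a + \<Phi> b c d a'"
    and bal: "\<And>t a b c d. a \<in> V \<Longrightarrow> b \<in> V \<Longrightarrow> c \<in> V \<Longrightarrow> d \<in> V \<Longrightarrow>
      \<Phi> (\<lambda>x. t * a x) b c d = \<Phi> a (\<lambda>x. t * b x) c d \<and>
      \<Phi> a b (\<lambda>x. t * c x) d = \<Phi> a b c (\<lambda>x. t * d x)"
    and ps: "represents_coproduct G a ps" and qs: "represents_coproduct G b qs"
  shows "sweedler G a (\<lambda>a1 a2. sweedler G b (\<Phi> a1 a2)) =
    (\<Sum>(u, v)\<leftarrow>ps. \<Sum>(u', v')\<leftarrow>qs. \<Phi> u v u' v')"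
proof -
  have sub: "set ps \<subseteq> V \<times> V" "set qs \<subseteq> V \<times> V"
    using ps qs by (auto simp: represents_coproduct_def V_def)
  have inner: "sweedler G b (\<Phi> a1 a2) = (\<Sum>(u', v')\<leftarrow>qs. \<Phi> a1 a2 u' v')"
    if "a1 \<in> V" "a2 \<in> V" for a1 a2
    by (rule sweedler_eq) (use that add bal qs in \<open>auto simp: V_def\<close>)
  have closed: "a + b \<in> V" "(\<lambda>x. t * a x) \<in> V" if "a \<in> V" "b \<in> V" for a b t
    using that regular_closed by (auto simp: V_def)
  have "sweedler G a (\<lambda>a1 a2. sweedler G b (\<Phi> a1 a2)) =
    (\<Sum>(u, v)\<leftarrow>ps. sweedler G b (\<Phi> u v))"
  proof (rule sweedler_eq[OF _ _ _ ps], fold V_def)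
    fix x y z assume V: "x \<in> V" "y \<in> V" "z \<in> V"
    have "(\<Sum>(u', v')\<leftarrow>qs. \<Phi> (x + y) z u' v') =
        (\<Sum>(u', v')\<leftarrow>qs. \<Phi> x z u' v') + (\<Sum>(u', v')\<leftarrow>qs. \<Phi> y z u' v')"
      using sub(2) by (induction qs) (auto simp: add V algebra_simps)
    then show "sweedler G b (\<Phi> (x + y) z) = sweedler G b (\<Phi> x z) + sweedler G b (\<Phi> y z)"
      using V by (simp add: inner closed)
    have "(\<Sum>(u', v')\<leftarrow>qs. \<Phi> z (x + y) u' v') =
        (\<Sum>(u', v')\<leftarrow>qs. \<Phi> z x u' v') + (\<Sum>(u', v')\<leftarrow>qs. \<Phi> z y u' v')"
      using sub(2) by (induction qs) (auto simp: add V algebra_simps)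
    then show "sweedler G b (\<Phi> z (x + y)) = sweedler G b (\<Phi> z x) + sweedler G b (\<Phi> z y)"
      using V by (simp add: inner closed)
  next
    fix t x y assume V: "x \<in> V" "y \<in> V"
    have "(\<Sum>(u', v')\<leftarrow>qs. \<Phi> (\<lambda>g. t * x g) y u' v') =
        (\<Sum>(u', v')\<leftarrow>qs. \<Phi> x (\<lambda>g. t * y g) u' v')"
      using sub(2) by (intro sum_list_case_prod_cong) (auto simp: bal V)
    then show "sweedler G b (\<Phi> (\<lambda>g. t * x g) y) = sweedler G b (\<Phi> x (\<lambda>g. t * y g))"
      using V by (simp add: inner closed)
  qed
  also have "\<dots> = (\<Sum>(u, v)\<leftarrow>ps. \<Sum>(u', v')\<leftarrow>qs. \<Phi> u v u' v')"
    by (intro sum_list_case_prod_cong inner) (use sub(1) in auto)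
  finally show ?thesis .
qed

lemma convolution_eq:
  assumes J: "bilinear_form G J" and K: "bilinear_form G K"
    and ps: "represents_coproduct G a ps" and qs: "represents_coproduct G b qs"
  shows "convolution G J K a b = (\<Sum>(u, v)\<leftarrow>ps. \<Sum>(u', v')\<leftarrow>qs. J u u' * K v v')"
  unfolding convolution_def
  by (rule sweedler_sweedler_eq[OF _ _ ps qs])
    (simp_all add: bilinear_formD[OF J] bilinear_formD[OF K] algebra_simps)

lemma twisted_mult_eq:
  assumes J: "bilinear_form G J"
    and ps: "represents_coproduct G a ps" and qs: "represents_coproduct G b qs"
  shows "twisted_mult G J a b = (\<Sum>(u, v)\<leftarrow>ps. \<Sum>(u', v')\<leftarrow>qs. (\<lambda>g. J v v' * (u * u') g))"
  unfolding twisted_mult_def regular_algebra_simps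
  by (rule sweedler_sweedler_eq[OF _ _ ps qs])
    (simp_all add: bilinear_formD[OF J] fun_eq_iff algebra_simps)

section \<open>Left and right translates\<close>

text \<open>In Sweedler notation this is \<open>\<Sum> a\<^sub>1(g) a\<^sub>2\<close>, and
  \<open>right_translate G h a\<close> is \<open>\<Sum> a\<^sub>1 a\<^sub>2(h)\<close>: one leg of
  the coproduct is evaluated at a point. The wrapper \<open>on_group\<close> restores extension by
  0.\<close>

definition left_translate :: "('g, 'm) monoid_scheme \<Rightarrow> 'g \<Rightarrow> ('g \<Rightarrow> complex) \<Rightarrow> 'g \<Rightarrow> complex"
  where "left_translate G g a = on_group G (\<lambda>h. a (g \<otimes>\<^bsub>G\<^esub> h))"

definition right_translate :: "('g, 'm) monoid_scheme \<Rightarrow> 'g \<Rightarrow> ('g \<Rightarrow> complex) \<Rightarrow> 'g \<Rightarrow> complex"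
  where "right_translate G h a = on_group G (\<lambda>g. a (g \<otimes>\<^bsub>G\<^esub> h))"

lemma right_translate_simps:
  "right_translate G h 0 = 0"
  "right_translate G h (a + b) = right_translate G h a + right_translate G h b"
  "right_translate G h (a * b) = right_translate G h a * right_translate G h b"
  "right_translate G h (\<lambda>x. t * a x) = (\<lambda>x. t * right_translate G h a x)"
  by (auto simp: right_translate_def on_group_def)

text \<open>Right translation is a left action of the group. This makes the set of functions whose
  translates all lie in a given set invariant under translation.\<close>

lemma (in group) right_translate_right_translate:
  assumes "h \<in> carrier G" "k \<in> carrier G"
  shows "right_translate G k (right_translate G h a) = right_translate G (k \<otimes> h) a"
  using assms by (auto simp: right_translate_def on_group_def m_assoc)

lemma (in group) right_translate_one:
  assumes "\<And>x. x \<notin> carrier G \<Longrightarrow> a x = 0"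
  shows "right_translate G \<one> a = a"
  using assms by (auto simp: right_translate_def on_group_def)

context affine_algebraic_group
begin

text \<open>The equation holds at every point of the ambient space: off the group both sides vanish,
  since each right factor is regular and hence 0 there.\<close>

lemma left_translate_eq_sum:
  assumes ps: "represents_coproduct G a ps" and g: "g \<in> carrier G"
  shows "left_translate G g a = (\<lambda>h. \<Sum>(u, v)\<leftarrow>ps. u g * v h)"
proof
  fix h
  have sub: "set ps \<subseteq> carrier (\<O> G) \<times> carrier (\<O> G)"
    using ps by (simp add: represents_coproduct_def)
  show "left_translate G g a h = (\<Sum>(u, v)\<leftarrow>ps. u g * v h)"
  proof (cases "h \<in> carrier G")
    case True
    then show ?thesis
      using ps g by (simp add: left_translate_def on_group_def represents_coproduct_def)
  next
    case False
    have "(\<Sum>(u, v)\<leftarrow>ps. u g * v h) = 0"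
      using sub False by (induction ps) (auto simp: regular_closed(5))
    then show ?thesis using False by (simp add: left_translate_def on_group_def)
  qed
qed

lemma bilinear_form_left_translate:
  assumes J: "bilinear_form G J" and ps: "represents_coproduct G a ps"
    and g: "g \<in> carrier G" and b: "b \<in> carrier (\<O> G)"
  shows "J (left_translate G g a) b = (\<Sum>(u, v)\<leftarrow>ps. u g * J v b)"
    and "J b (left_translate G g a) = (\<Sum>(u, v)\<leftarrow>ps. u g * J b v)"
proof -
  have "set ps \<subseteq> carrier (\<O> G) \<times> carrier (\<O> G)"
    using ps by (simp add: represents_coproduct_def)
  then show "J (left_translate G g a) b = (\<Sum>(u, v)\<leftarrow>ps. u g * J v b)"
    "J b (left_translate G g a) = (\<Sum>(u, v)\<leftarrow>ps. u g * J b v)"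
    unfolding left_translate_eq_sum[OF ps g]
    using bilinear_form_sum_left[OF J b] bilinear_form_sum_left[OF bilinear_form_flip[OF J] b]
    by simp_all
qed

lemma left_translate_closed:
  assumes "a \<in> carrier (\<O> G)" "g \<in> carrier G"
  shows "left_translate G g a \<in> carrier (\<O> G)"
proof -
  obtain ps where ps: "represents_coproduct G a ps" using coproduct_exists assms by blast
  \<comment> \<open>Any form serves here, as only the membership clause of
    \<open>bilinear_form_sum_left\<close> is wanted.\<close>
  have zero_form: "bilinear_form G (\<lambda>_ _. 0)" by (simp add: bilinear_form_def)
  show ?thesis
    unfolding left_translate_eq_sum[OF ps assms(2)]
    using bilinear_form_sum_left[OF zero_form regular_closed(1)] ps
    by (auto simp: represents_coproduct_def)
qed

text \<open>Associativity: \<open>a (g (k h))\<close> is the coproduct of \<open>a\<close> read at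
  the pair \<open>(g k, h)\<close>. Left translation therefore affects only the left
  factors.\<close>

lemma represents_coproduct_left_translate:
  assumes ps: "represents_coproduct G a ps" and g: "g \<in> carrier G"
  shows "represents_coproduct G (left_translate G g a)
    (map (\<lambda>(u, v). (left_translate G g u, v)) ps)"
proof -
  have sub: "set ps \<subseteq> carrier (\<O> G) \<times> carrier (\<O> G)"
    using ps by (simp add: represents_coproduct_def)
  have "left_translate G g a (k \<otimes> h) = (\<Sum>(u, v)\<leftarrow>ps. left_translate G g u k * v h)"
    if "k \<in> carrier G" "h \<in> carrier G" for k h
  proof -
    have "left_translate G g a (k \<otimes> h) = a ((g \<otimes> k) \<otimes> h)"
      using that g by (simp add: left_translate_def on_group_def m_assoc)
    also have "\<dots> = (\<Sum>(u, v)\<leftarrow>ps. u (g \<otimes> k) * v h)"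
      using ps that g unfolding represents_coproduct_def by blast
    finally show ?thesis using that by (simp add: left_translate_def on_group_def)
  qed
  then show ?thesis
    using sub left_translate_closed[OF _ g]
    by (auto simp: represents_coproduct_def case_prod_unfold comp_def)
qed

section \<open>The twisted product and its inversion\<close>

text \<open>In \<open>\<Sum> a\<^sub>1(g) b\<^sub>1(g) J(a\<^sub>2, b\<^sub>2)\<close> the scalars
  \<open>a\<^sub>1(g)\<close> and \<open>b\<^sub>1(g)\<close> move into the arguments of
  \<open>J\<close> by bilinearity and turn them into left translates. Identities for
  \<open>twisted_mult\<close> thereby become identities between values of forms.\<close>

lemma twisted_mult_apply:
  assumes J: "bilinear_form G J" and a: "a \<in> carrier (\<O> G)" and b: "b \<in> carrier (\<O> G)"
    and g: "g \<in> carrier G"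
  shows "twisted_mult G J a b g = J (left_translate G g a) (left_translate G g b)"
proof -
  obtain ps qs where ps: "represents_coproduct G a ps" and qs: "represents_coproduct G b qs"
    using coproduct_exists a b by blast
  have "J (left_translate G g a) (left_translate G g b) =
      (\<Sum>(u, v)\<leftarrow>ps. u g * (\<Sum>(u', v')\<leftarrow>qs. u' g * J v v'))"
    unfolding bilinear_form_left_translate(1)[OF J ps g left_translate_closed[OF b g]]
    by (intro sum_list_case_prod_cong arg_cong2[of _ _ _ _ "(*)"] refl
        bilinear_form_left_translate(2)[OF J qs g])
      (use ps in \<open>auto simp: represents_coproduct_def\<close>)
  also have "\<dots> = (\<Sum>(u, v)\<leftarrow>ps. \<Sum>(u', v')\<leftarrow>qs. J v v' * (u g * u' g))"
    unfolding case_prod_unfold sum_list_const_mult[symmetric] by (simp add: algebra_simps)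
  also have "\<dots> = twisted_mult G J a b g"
    unfolding twisted_mult_eq[OF J ps qs] sum_list_case_prod_apply by simp
  finally show ?thesis by simp
qed

lemma twisted_mult_closed:
  assumes J: "bilinear_form G J" and a: "a \<in> carrier (\<O> G)" and b: "b \<in> carrier (\<O> G)"
  shows "twisted_mult G J a b \<in> carrier (\<O> G)"
proof -
  obtain ps qs where ps: "represents_coproduct G a ps" and qs: "represents_coproduct G b qs"
    using coproduct_exists a b by blast
  show ?thesis unfolding twisted_mult_eq[OF J ps qs]
    by (intro sum_list_case_prod_closed regular_closed(1-4))
      (use ps qs in \<open>auto simp: represents_coproduct_def\<close>)
qed

text \<open>At \<open>g\<close>, the sum is the convolution \<open>J * K\<close> evaluated at the left translates by \<open>g\<close>.\<close>

lemma mult_eq_sum_twisted_mult: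
  assumes J: "bilinear_form G J" and K: "bilinear_form G K"
    and inverse: "\<And>a b. a \<in> carrier (\<O> G) \<Longrightarrow> b \<in> carrier (\<O> G) \<Longrightarrow>
      convolution G J K a b = counit G a * counit G b"
    and a: "a \<in> carrier (\<O> G)" and b: "b \<in> carrier (\<O> G)"
    and ps: "represents_coproduct G a ps" and qs: "represents_coproduct G b qs"
  shows "a * b = (\<Sum>(u, v)\<leftarrow>ps. \<Sum>(u', v')\<leftarrow>qs. (\<lambda>g. K v v' * twisted_mult G J u u' g))"
proof
  fix g
  have sub: "set ps \<subseteq> carrier (\<O> G) \<times> carrier (\<O> G)" "set qs \<subseteq> carrier (\<O> G) \<times> carrier (\<O> G)"
    using ps qs by (auto simp: represents_coproduct_def)
  have "(a * b) g = (\<Sum>(u, v)\<leftarrow>ps. \<Sum>(u', v')\<leftarrow>qs. K v v' * twisted_mult G J u u' g)"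
  proof (cases "g \<in> carrier G")
    case True
    let ?L = "left_translate G g"
    have "(a * b) g = counit G (?L a) * counit G (?L b)"
      using True by (simp add: counit_def left_translate_def on_group_def)
    also have "\<dots> = convolution G J K (?L a) (?L b)"
      using inverse left_translate_closed a b True by simp
    \<comment> \<open>Only the left factors carry the translation, so \<open>K\<close> is evaluated
      at the original right factors \<open>v\<close> and \<open>v'\<close>.\<close>
    also have "\<dots> = (\<Sum>(u, v)\<leftarrow>ps. \<Sum>(u', v')\<leftarrow>qs. J (?L u) (?L u') * K v v')"
      unfolding convolution_eq[OF J K represents_coproduct_left_translate[OF ps True]
          represents_coproduct_left_translate[OF qs True]]
      by (simp add: case_prod_unfold comp_def)
    also have "\<dots> = (\<Sum>(u, v)\<leftarrow>ps. \<Sum>(u', v')\<leftarrow>qs. K v v' * twisted_mult G J u u' g)"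
      by (intro sum_list_case_prod_cong, subst twisted_mult_apply[OF J])
        (use sub True in auto)
    finally show ?thesis .
  next
    case False
    then have "twisted_mult G J u u' g = 0"
      if "u \<in> carrier (\<O> G)" "u' \<in> carrier (\<O> G)" for u u'
      using regular_closed(5)[OF twisted_mult_closed[OF J that]] by blast
    then have "(\<Sum>(u, v)\<leftarrow>ps. \<Sum>(u', v')\<leftarrow>qs. K v v' * twisted_mult G J u u' g) =
        (\<Sum>(u, v)\<leftarrow>ps. \<Sum>(u', v')\<leftarrow>qs. 0)"
      by (intro sum_list_case_prod_cong) (use sub in auto)
    then show ?thesis using regular_closed(5)[OF a False] by (simp add: case_prod_unfold)
  qed
  then show "(a * b) g =
      (\<Sum>(u, v)\<leftarrow>ps. \<Sum>(u', v')\<leftarrow>qs. (\<lambda>g. K v v' * twisted_mult G J u u' g)) g"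
    by (simp add: sum_list_case_prod_apply)
qed

section \<open>Right-invariant subspaces and the coproduct\<close>

text \<open>All right translates of \<open>a\<close> lie in the span of the left factors of one
  fixed tensor representing its coproduct. This is why finitely many generators can capture every
  translate of a coordinate function.\<close>

lemma right_translate_eq_sum:
  assumes ps: "represents_coproduct G a ps" and h: "h \<in> carrier G"
  shows "right_translate G h a = (\<Sum>(u, v)\<leftarrow>ps. (\<lambda>g. v h * u g))"
proof
  fix g
  have sub: "set ps \<subseteq> carrier (\<O> G) \<times> carrier (\<O> G)"
    using ps by (simp add: represents_coproduct_def)
  have "right_translate G h a g = (\<Sum>(u, v)\<leftarrow>ps. u g * v h)"
  proof (cases "g \<in> carrier G")
    case True
    then show ?thesis
      using ps h by (simp add: right_translate_def on_group_def represents_coproduct_def)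
  next
    case False
    have "(\<Sum>(u, v)\<leftarrow>ps. u g * v h) = 0"
      using sub False by (induction ps) (auto simp: regular_closed(5))
    then show ?thesis using False by (simp add: right_translate_def on_group_def)
  qed
  then show "right_translate G h a g = (\<Sum>(u, v)\<leftarrow>ps. (\<lambda>g. v h * u g)) g"
    by (simp add: sum_list_case_prod_apply mult.commute)
qed

text \<open>The slice of the coproduct of \<open>a\<close> at \<open>h\<close> is the right
  translate of \<open>a\<close> by \<open>h\<close>, which lies in \<open>Q\<close> by invariance;
  \<open>tensor_left_factors\<close> then moves the left factors into \<open>Q\<close>.\<close>

lemma coproduct_in_invariant_subspace:
  assumes Q0: "0 \<in> Q" and Qadd: "\<And>a b. a \<in> Q \<Longrightarrow> b \<in> Q \<Longrightarrow> a + b \<in> Q"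
    and Qsc: "\<And>t a. a \<in> Q \<Longrightarrow> (\<lambda>x. t * a x) \<in> Q"
    and QV: "Q \<subseteq> carrier (\<O> G)"
    and Qtr: "\<And>h a. a \<in> Q \<Longrightarrow> h \<in> carrier G \<Longrightarrow> right_translate G h a \<in> Q"
    and a: "a \<in> Q"
  shows "\<exists>ps. represents_coproduct G a ps \<and> fst ` set ps \<subseteq> Q"
proof -
  let ?V = "carrier (\<O> G)"
  obtain ps where ps: "represents_coproduct G a ps" using coproduct_exists a QV by blast
  \<comment> \<open>The value 0 for \<open>h\<close> outside the group makes the tensor identity
    hold at all pairs of points; the additional slices are 0 and lie in \<open>Q\<close>.\<close>
  define F where "F g h = (if h \<in> carrier G then right_translate G h a g else 0)" for g h
  have sub: "set ps \<subseteq> ?V \<times> ?V" using ps by (simp add: represents_coproduct_def)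
  have snd_V: "snd ` set ps \<subseteq> ?V" using sub by auto
  have F_eq: "F g h = (\<Sum>(u, v)\<leftarrow>ps. u g * v h)" for g h
  proof (cases "h \<in> carrier G")
    case True
    then show ?thesis
      by (simp add: F_def right_translate_eq_sum[OF ps] sum_list_case_prod_apply mult.commute)
  next
    case False
    then have "(\<Sum>(u, v)\<leftarrow>ps. u g * v h) = 0"
      using sub by (induction ps) (auto simp: regular_closed(5))
    then show ?thesis using False by (simp add: F_def)
  qed
  have F_Q: "(\<lambda>g. F g h) \<in> Q" for h
    using Qtr[OF a] Q0 by (cases "h \<in> carrier G") (simp_all add: F_def zero_fun_def)
  obtain qs where qs: "set qs \<subseteq> Q \<times> ?V" "\<forall>g h. F g h = (\<Sum>(u, v)\<leftarrow>qs. u g * v h)"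
    using tensor_left_factors[OF Q0 Qadd Qsc regular_closed(2,4) snd_V F_eq F_Q] by blast
  have "represents_coproduct G a qs"
    unfolding represents_coproduct_def
  proof (intro conjI ballI)
    show "set qs \<subseteq> ?V \<times> ?V" using qs(1) QV by auto
    fix g h assume "g \<in> carrier G" "h \<in> carrier G"
    then show "a (g \<otimes> h) = (\<Sum>(u, v)\<leftarrow>qs. u g * v h)"
      using qs(2)[rule_format, of g h] by (simp add: F_def right_translate_def on_group_def)
  qed
  moreover have "fst ` set qs \<subseteq> Q" using qs(1) by auto
  ultimately show ?thesis by blast
qed

section \<open>Generation of the twisted algebra\<close>

text \<open>Induction over polynomial functions, carried through restriction to the group. It
  reduces \<open>Q = \<O>(G)\<close> to closure under sums and the ordinary product.\<close>

lemma regular_induct: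
  assumes a: "a \<in> carrier (\<O> G)"
    and const: "\<And>c. on_group G (\<lambda>_. c) \<in> Q"
    and coord: "\<And>i. on_group G (\<lambda>x. x $ i) \<in> Q"
    and add: "\<And>a b. a \<in> Q \<Longrightarrow> b \<in> Q \<Longrightarrow> a + b \<in> Q"
    and mult: "\<And>a b. a \<in> Q \<Longrightarrow> b \<in> Q \<Longrightarrow> a * b \<in> Q"
  shows "a \<in> Q"
proof -
  obtain p where p: "p \<in> poly_functions coords" and a_eq: "a = on_group G p"
    using a by (auto simp: regular_algebra_def)
  from p have "on_group G p \<in> Q"
  proof induction
    case (add f g)
    have eq: "on_group G (f + g) = on_group G f + on_group G g" by (auto simp: on_group_def)
    show ?case unfolding eq by (rule assms(4)[OF add.IH])
  next
    case (mult f g)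
    have eq: "on_group G (f * g) = on_group G f * on_group G g" by (auto simp: on_group_def)
    show ?case unfolding eq by (rule assms(5)[OF mult.IH])
  qed (auto simp: coords_def const coord)
  then show ?thesis by (simp add: a_eq)
qed

lemma generated_twisted_subset:
  assumes J: "bilinear_form G J" and S: "S \<subseteq> carrier (\<O> G)"
  shows "generated_subalgebra (twisted_algebra G J) S \<subseteq> carrier (\<O> G)"
proof
  fix a assume "a \<in> generated_subalgebra (twisted_algebra G J) S"
  then show "a \<in> carrier (\<O> G)"
  proof induction
    case (add a b)
    show ?case using regular_closed(2)[OF add.IH] by (simp add: plus_fun_def)
  qed (use S in \<open>auto intro: on_group_const_regular regular_closed(4)
      twisted_mult_closed[OF J]\<close>)
qed

text \<open>The translates of the coordinate functions are combinations of elements of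
  \<open>S\<close>, which places the coordinates in \<open>Q\<close>. As \<open>Q\<close> is closed
  under the ordinary product, \<open>regular_induct\<close> gives all regular functions.\<close>

lemma generated_twisted_eq_carrier:
  assumes J: "bilinear_form G J" and K: "bilinear_form G K"
    and inverse: "\<And>a b. a \<in> carrier (\<O> G) \<Longrightarrow> b \<in> carrier (\<O> G) \<Longrightarrow>
      convolution G J K a b = counit G a * counit G b"
    and S: "S \<subseteq> carrier (\<O> G)"
    and cs: "\<And>i. represents_coproduct G (on_group G (\<lambda>x. x $ i)) (cs i)"
    and cs_S: "\<And>i. fst ` set (cs i) \<subseteq> S"
  shows "generated_subalgebra (twisted_algebra G J) S = carrier (\<O> G)"
proof
  let ?V = "carrier (\<O> G)"
  let ?A = "twisted_algebra G J"
  let ?B = "generated_subalgebra ?A S"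
  \<comment> \<open>The largest subspace of \<open>?B\<close> invariant under right translation. It
    replaces \<open>?B\<close>, whose invariance is not known beforehand, because
    \<open>coproduct_in_invariant_subspace\<close> requires an invariant subspace.\<close>
  define Q where "Q = {a \<in> ?V. \<forall>h \<in> carrier G. right_translate G h a \<in> ?B}"
  show BV: "?B \<subseteq> ?V" by (rule generated_twisted_subset[OF J S])
  have B_add: "a + b \<in> ?B" if "a \<in> ?B" "b \<in> ?B" for a b
    using generated_subalgebra.add[OF that] by simp
  have B_sc: "(\<lambda>x. t * a x) \<in> ?B" if "a \<in> ?B" for a t
    using generated_subalgebra.smult[OF that, of t] by simp
  have B_mult: "twisted_mult G J a b \<in> ?B" if "a \<in> ?B" "b \<in> ?B" for a b
    using generated_subalgebra.mult[OF that] by simp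
  have B_const: "on_group G (\<lambda>_. c) \<in> ?B" for c
  proof -
    have "on_group G (\<lambda>_. c) = (\<lambda>x. c * on_group G (\<lambda>_. 1) x)" by (auto simp: on_group_def)
    then show ?thesis using B_sc[OF generated_subalgebra.one[of ?A S]] by simp
  qed
  have B0: "0 \<in> ?B"
  proof -
    have "0 = on_group G (\<lambda>_. 0)" by (auto simp: on_group_def)
    then show ?thesis using B_const by metis
  qed
  have B_sum: "(\<Sum>(u, v)\<leftarrow>xs. F u v) \<in> ?B" if "\<And>u v. (u, v) \<in> set xs \<Longrightarrow> F u v \<in> ?B"
    for xs :: "((complex^'n \<Rightarrow> complex) \<times> (complex^'n \<Rightarrow> complex)) list" and F
    by (rule sum_list_case_prod_closed[OF B0 B_add that])
  \<comment> \<open>Translation by the identity.\<close>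
  have Q_B: "a \<in> ?B" if "a \<in> Q" for a
  proof -
    have a: "a \<in> ?V" "right_translate G \<one> a \<in> ?B" using that by (auto simp: Q_def)
    then show ?thesis using right_translate_one[OF regular_closed(5)[OF a(1)]] by simp
  qed
  have Q_tr: "right_translate G h a \<in> Q" if "a \<in> Q" "h \<in> carrier G" for a h
    using that BV by (auto simp: Q_def right_translate_right_translate)
  have Q0: "0 \<in> Q" using B0 by (simp add: Q_def right_translate_simps regular_closed(1))
  have Q_add: "a + b \<in> Q" if "a \<in> Q" "b \<in> Q" for a b
    using that by (simp add: Q_def right_translate_simps regular_closed(2) B_add)
  have Q_sc: "(\<lambda>x. t * a x) \<in> Q" if "a \<in> Q" for a t
    using that by (simp add: Q_def right_translate_simps regular_closed(4) B_sc)
  \<comment> \<open>The left factors of both coproducts can be taken in \<open>Q\<close>, hence in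
    \<open>?B\<close>. In the inversion formula each twisted product then stays in
    \<open>?B\<close>, and the right factors enter only through the scalars
    \<open>K v v'\<close>.\<close>
  have mult_B: "a * b \<in> ?B" if ab: "a \<in> Q" "b \<in> Q" for a b
  proof -
    have QV: "Q \<subseteq> ?V" by (auto simp: Q_def)
    obtain ps qs where ps: "represents_coproduct G a ps" "fst ` set ps \<subseteq> Q"
      and qs: "represents_coproduct G b qs" "fst ` set qs \<subseteq> Q"
      using coproduct_in_invariant_subspace[OF Q0 Q_add Q_sc QV Q_tr] ab by meson
    have eq: "a * b =
        (\<Sum>(u, v)\<leftarrow>ps. \<Sum>(u', v')\<leftarrow>qs. (\<lambda>g. K v v' * twisted_mult G J u u' g))"
      by (rule mult_eq_sum_twisted_mult[OF J K]) (use ab QV inverse ps(1) qs(1) in auto)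
    show ?thesis unfolding eq
    proof (intro B_sum B_sc B_mult Q_B)
      show "u \<in> Q" if "(u, v) \<in> set ps" for u v using that ps(2) by force
      show "u' \<in> Q" if "(u', v') \<in> set qs" for u' v' using that qs(2) by force
    qed
  qed
  \<comment> \<open>A translate of \<open>a * b\<close> is the ordinary product of the translates,
    which are again in \<open>Q\<close>; thus \<open>mult_B\<close> applies to them too.\<close>
  have Q_mult: "a * b \<in> Q" if "a \<in> Q" "b \<in> Q" for a b
    using that mult_B Q_tr by (auto simp: Q_def right_translate_simps regular_closed(3))
  have Q_const: "on_group G (\<lambda>_. c) \<in> Q" for c
  proof -
    have "right_translate G h (on_group G (\<lambda>_. c)) = on_group G (\<lambda>_. c)"
      if "h \<in> carrier G" for h
      using that by (auto simp: right_translate_def on_group_def)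
    then show ?thesis using B_const by (simp add: Q_def on_group_const_regular)
  qed
  have Q_coord: "on_group G (\<lambda>x. x $ i) \<in> Q" for i
  proof -
    have "right_translate G h (on_group G (\<lambda>x. x $ i)) \<in> ?B" if "h \<in> carrier G" for h
      unfolding right_translate_eq_sum[OF cs that]
    proof (intro B_sum B_sc generated_subalgebra.gen)
      show "u \<in> S" if "(u, v) \<in> set (cs i)" for u v using that cs_S[of i] by force
    qed
    then show ?thesis by (simp add: Q_def on_group_coord_regular)
  qed
  show "?V \<subseteq> ?B"
    using regular_induct[OF _ Q_const Q_coord Q_add Q_mult] Q_B by blast
qed

end

theorem proposition3p4:
  fixes G :: "(complex^'n) monoid" and J :: "'n form"
  assumes "affine_algebraic_group G"
    and "hopf_2_cocycle G J"
  shows "finitely_generated_algebra (twisted_algebra G J)"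
proof -
  interpret affine_algebraic_group G by fact
  have J: "bilinear_form G J" using assms(2) by (simp add: hopf_2_cocycle_def)
  obtain K where K: "bilinear_form G K"
    and inverse: "\<And>a b. a \<in> carrier (\<O> G) \<Longrightarrow> b \<in> carrier (\<O> G) \<Longrightarrow>
      convolution G J K a b = counit G a * counit G b"
    using assms(2) unfolding hopf_2_cocycle_def convolution_invertible_def by blast
  have "\<forall>i. \<exists>ps. represents_coproduct G (on_group G (\<lambda>x. x $ i)) ps"
    by (intro allI coproduct_exists on_group_coord_regular)
  from choice[OF this]
  obtain cs where cs: "\<And>i. represents_coproduct G (on_group G (\<lambda>x. x $ i)) (cs i)" by blast
  \<comment> \<open>All left factors of the chosen coproducts of the coordinates. This set is finite
    because the index type \<open>'n\<close> is finite and each \<open>cs i\<close> is a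
    list.\<close>
  define S where "S = (\<Union>i. fst ` set (cs i))"
  have S: "S \<subseteq> carrier (\<O> G)"
  proof -
    have "set (cs i) \<subseteq> carrier (\<O> G) \<times> carrier (\<O> G)" for i
      using cs by (simp add: represents_coproduct_def)
    then show ?thesis unfolding S_def by fastforce
  qed
  have "generated_subalgebra (twisted_algebra G J) S = carrier (\<O> G)"
    by (rule generated_twisted_eq_carrier[OF J K _ S cs]) (use inverse in \<open>auto simp: S_def\<close>)
  moreover have "finite S" by (simp add: S_def)
  ultimately show ?thesis
    unfolding finitely_generated_algebra_def using S by (intro exI[of _ S]) simp
qed

end
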